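(* For $n=23$, $\lambda=(7,6,4,3,2,1)$ and $\mu=(10,8,5)$, the space $X_{\lambda,\mu}$ is disconnected. (In particular, it is not true in general that for number partitions $\lambda\ne\mu$ with $\lambda$ refining $\mu$ the space $X_{\lambda,\mu}$ is $\mathbb{Q}$-acyclic, which disproves a conjecture of Sundaram and Welker.)
   Context: The type of a set partition is the number partition formed by its block sizes. $\Pi_n$ is the lattice of set partitions of $[n]$ ordered by refinement, $\hat 0$ the partition into singletons. For a number partition $\lambda$ of $n$, $\Pi_\lambda$ is the subposet of $\Pi_n$ consisting of $\hat 0$ and all joins (in $\Pi_n$) of elements of type $\lambda$. For a set partition $\pi\in\Pi_\lambda$ of type $\mu$, $X_{\lambda,\mu}=\Delta(\Pi_\lambda(\hat 0,\pi))/\mathrm{Stab}(\pi)$, where $\Pi_\lambda(\hat 0,\pi)$ is the open interval in $\Pi_\lambda$, $\Delta$ is the order complex, and $\mathrm{Stab}(\pi)$ is the stabilizer of $\pi$ in the symmetric group $\mathcal{S}_n$; up to homeomorphism this depends only on $\lambda,\mu$. *)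

theory Defs
  imports
    "HOL-Homology.Homology"
    "HOL-Library.Disjoint_Sets"
    "HOL-Library.Multiset"
    "HOL-Combinatorics.Permutations"
begin

section \<open>Number partitions and set partitions\<close>

definition number_partition :: "nat \<Rightarrow> nat multiset \<Rightarrow> bool"
  where "number_partition n l \<longleftrightarrow> (\<forall>k\<in>#l. 0 < k) \<and> sum_mset l = n"

text \<open>\<open>l\<close> refines \<open>m\<close> if the parts of \<open>l\<close> can be grouped so that the group sums are the
  parts of \<open>m\<close>; \<open>G\<close> is the multiset of groups.\<close>

definition number_partition_refines :: "nat multiset \<Rightarrow> nat multiset \<Rightarrow> bool"
  where "number_partition_refines l m \<longleftrightarrow>
    (\<exists>G :: nat multiset multiset. sum_mset G = l \<and> image_mset sum_mset G = m)"

abbreviation set_partition :: "nat \<Rightarrow> nat set set \<Rightarrow> bool"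
  where "set_partition n \<equiv> partition_on {1..n}"

definition partition_type :: "nat set set \<Rightarrow> nat multiset"
  where "partition_type P = image_mset card (mset_set P)"

definition singletons :: "nat \<Rightarrow> nat set set"
  where "singletons n = (\<lambda>i. {i}) ` {1..n}"

text \<open>\<open>\<Pi>\<^sub>n\<close> is the set of all \<open>P\<close> with \<open>set_partition n P\<close>, ordered by the library relation
  \<open>refines {1..n}\<close>; the finer partition is the smaller one.\<close>

definition is_join :: "nat \<Rightarrow> nat set set set \<Rightarrow> nat set set \<Rightarrow> bool"
  where "is_join n S P \<longleftrightarrow>
    set_partition n P \<and> (\<forall>Q\<in>S. refines {1..n} Q P) \<and>
    (\<forall>R. set_partition n R \<and> (\<forall>Q\<in>S. refines {1..n} Q R) \<longrightarrow> refines {1..n} P R)"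

definition Pi_sub :: "nat \<Rightarrow> nat multiset \<Rightarrow> nat set set set"
  where "Pi_sub n l = insert (singletons n)
    {P. \<exists>S. S \<noteq> {} \<and> S \<subseteq> {Q. set_partition n Q \<and> partition_type Q = l} \<and> is_join n S P}"

definition Pi_interval :: "nat \<Rightarrow> nat multiset \<Rightarrow> nat set set \<Rightarrow> nat set set set"
  where "Pi_interval n l P =
    {Q \<in> Pi_sub n l. refines {1..n} (singletons n) Q \<and> Q \<noteq> singletons n \<and>
                     refines {1..n} Q P \<and> Q \<noteq> P}"


section \<open>Order complexes and their geometric realizations\<close>

definition order_complex :: "('a \<Rightarrow> 'a \<Rightarrow> bool) \<Rightarrow> 'a set \<Rightarrow> 'a set set"
  where "order_complex r A =
    {C. C \<subseteq> A \<and> finite C \<and> C \<noteq> {} \<and> Complete_Partial_Order.chain r C}"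

text \<open>Points are given by barycentric coordinates. The topology of pointwise convergence is the
  usual one only for complexes with finitely many vertices.\<close>

definition geometric_realization :: "'a set set \<Rightarrow> ('a \<Rightarrow> real) topology"
  where "geometric_realization K = subtopology (powertop_real UNIV)
    {x. (\<forall>v. 0 \<le> x v) \<and> {v. x v \<noteq> 0} \<in> K \<and> (\<Sum>v | x v \<noteq> 0. x v) = 1}"


section \<open>Orbit spaces\<close>

definition action_orbit :: "('g \<Rightarrow> 'x \<Rightarrow> 'x) \<Rightarrow> 'g set \<Rightarrow> 'x \<Rightarrow> 'x set"
  where "action_orbit act G x = (\<lambda>g. act g x) ` G"

definition orbit_space :: "('g \<Rightarrow> 'x \<Rightarrow> 'x) \<Rightarrow> 'g set \<Rightarrow> 'x topology \<Rightarrow> 'x set topology"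
  where "orbit_space act G X = topology (\<lambda>U.
    U \<subseteq> action_orbit act G ` topspace X \<and> openin X {x \<in> topspace X. action_orbit act G x \<in> U})"

lemma openin_orbit_space:
  "openin (orbit_space act G X) U \<longleftrightarrow>
    U \<subseteq> action_orbit act G ` topspace X \<and> openin X {x \<in> topspace X. action_orbit act G x \<in> U}"
proof -
  have "istopology (\<lambda>U. U \<subseteq> action_orbit act G ` topspace X \<and>
                        openin X {x \<in> topspace X. action_orbit act G x \<in> U})"
    unfolding istopology_def
  proof (intro conjI allI impI)
    fix S T
    assume S: "S \<subseteq> action_orbit act G ` topspace X \<and> openin X {x \<in> topspace X. action_orbit act G x \<in> S}"
      and T: "T \<subseteq> action_orbit act G ` topspace X \<and> openin X {x \<in> topspace X. action_orbit act G x \<in> T}"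
    show "S \<inter> T \<subseteq> action_orbit act G ` topspace X" using S by blast
    have "{x \<in> topspace X. action_orbit act G x \<in> S \<inter> T} =
        {x \<in> topspace X. action_orbit act G x \<in> S} \<inter> {x \<in> topspace X. action_orbit act G x \<in> T}"
      by blast
    then show "openin X {x \<in> topspace X. action_orbit act G x \<in> S \<inter> T}"
      using openin_Int[OF conjunct2[OF S] conjunct2[OF T]] by (simp only:)
  next
    fix \<K>
    assume K: "\<forall>U\<in>\<K>. U \<subseteq> action_orbit act G ` topspace X \<and>
                        openin X {x \<in> topspace X. action_orbit act G x \<in> U}"
    show "\<Union>\<K> \<subseteq> action_orbit act G ` topspace X" using K by blast
    have "{x \<in> topspace X. action_orbit act G x \<in> \<Union>\<K>} =
        \<Union> ((\<lambda>U. {x \<in> topspace X. action_orbit act G x \<in> U}) ` \<K>)"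
      by blast
    then show "openin X {x \<in> topspace X. action_orbit act G x \<in> \<Union>\<K>}"
      using K by (simp only:) (rule openin_Union, blast)
  qed
  then show ?thesis
    unfolding orbit_space_def by (simp add: topology_inverse')
qed

lemma topspace_orbit_space: "topspace (orbit_space act G X) = action_orbit act G ` topspace X"
proof
  show "topspace (orbit_space act G X) \<subseteq> action_orbit act G ` topspace X"
    using openin_topspace[of "orbit_space act G X"] unfolding openin_orbit_space by (rule conjunct1)
  have "{x \<in> topspace X. action_orbit act G x \<in> action_orbit act G ` topspace X} = topspace X"
    by blast
  then have "openin (orbit_space act G X) (action_orbit act G ` topspace X)"
    by (simp add: openin_orbit_space)
  then show "action_orbit act G ` topspace X \<subseteq> topspace (orbit_space act G X)"
    by (rule openin_subset)
qed

lemma quotient_map_action_orbit: "quotient_map X (orbit_space act G X) (action_orbit act G)"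
  unfolding quotient_map_def topspace_orbit_space openin_orbit_space by simp


section \<open>The space \<open>X\<^bsub>\<lambda>,\<mu>\<^esub>\<close>\<close>

definition permute_partition :: "(nat \<Rightarrow> nat) \<Rightarrow> nat set set \<Rightarrow> nat set set"
  where "permute_partition s P = (\<lambda>B. s ` B) ` P"

definition partition_stabilizer :: "nat \<Rightarrow> nat set set \<Rightarrow> (nat \<Rightarrow> nat) set"
  where "partition_stabilizer n P = {s. s permutes {1..n} \<and> permute_partition s P = P}"

text \<open>The action on barycentric coordinates that is induced by the action on vertices: the
  coordinate of \<open>s \<cdot> x\<close> at the vertex \<open>s \<cdot> P\<close> is the coordinate of \<open>x\<close> at \<open>P\<close>.\<close>

definition permute_point :: "(nat \<Rightarrow> nat) \<Rightarrow> (nat set set \<Rightarrow> real) \<Rightarrow> nat set set \<Rightarrow> real"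
  where "permute_point s x = (\<lambda>P. x (permute_partition (inv_into UNIV s) P))"

text \<open>Here \<open>P\<close> is an element of \<open>Pi_sub n l\<close> whose type is \<open>\<mu>\<close>.\<close>

definition X_space :: "nat \<Rightarrow> nat multiset \<Rightarrow> nat set set \<Rightarrow> (nat set set \<Rightarrow> real) set topology"
  where "X_space n l P = orbit_space permute_point (partition_stabilizer n P)
    (geometric_realization (order_complex (refines {1..n}) (Pi_interval n l P)))"


section \<open>Rational singular homology\<close>

text \<open>The singular chain complex of the library has integer coefficients; this is the same
  complex with rational coefficients.\<close>

type_synonym 'a rat_chain = "((nat \<Rightarrow> real) \<Rightarrow> 'a) \<Rightarrow>\<^sub>0 rat"

definition rat_singular_chain :: "nat \<Rightarrow> 'a topology \<Rightarrow> 'a rat_chain \<Rightarrow> bool"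
  where "rat_singular_chain p X c \<longleftrightarrow> Poly_Mapping.keys c \<subseteq> singular_simplex_set p X"

definition rat_boundary :: "nat \<Rightarrow> 'a rat_chain \<Rightarrow> 'a rat_chain"
  where "rat_boundary p c =
    (if p = 0 then 0
     else \<Sum>f\<in>Poly_Mapping.keys c. \<Sum>k\<le>p.
            Poly_Mapping.single (singular_face p k f) ((-1) ^ k * Poly_Mapping.lookup c f))"

definition augmentation :: "'a rat_chain \<Rightarrow> rat"
  where "augmentation c = (\<Sum>f\<in>Poly_Mapping.keys c. Poly_Mapping.lookup c f)"

definition rat_reduced_cycle :: "nat \<Rightarrow> 'a topology \<Rightarrow> 'a rat_chain \<Rightarrow> bool"
  where "rat_reduced_cycle p X c \<longleftrightarrow>
    rat_singular_chain p X c \<and> (if p = 0 then augmentation c = 0 else rat_boundary p c = 0)"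

text \<open>All reduced rational homology groups vanish. In degree \<open>-1\<close> this says that the space is
  nonempty.\<close>

definition rationally_acyclic :: "'a topology \<Rightarrow> bool"
  where "rationally_acyclic X \<longleftrightarrow> topspace X \<noteq> {} \<and>
    (\<forall>p c. rat_reduced_cycle p X c \<longrightarrow>
      (\<exists>d. rat_singular_chain (Suc p) X d \<and> rat_boundary (Suc p) d = c))"

end

theory Submission
  imports Defs
begin

text \<open>
  The parts of \<open>(7,6,4,3,2,1)\<close> can be grouped into \<open>(10,8,5)\<close> in exactly two ways,
  \<open>7+3 | 6+2 | 4+1\<close> and \<open>6+4 | 7+1 | 3+2\<close>. So every partition of type \<open>\<lambda>\<close> below \<open>P\<close> splits each
  block of \<open>P\<close> in two, according to one of two kinds, and no block is split into the same sizes
  by both kinds. Hence \<open>P\<close> is the only upper bound below \<open>P\<close> of two elements of different kinds,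
  so the open interval is the union of two nonempty sets without comparabilities between them.
  Both sets are invariant under the stabilizer of \<open>P\<close>, so the orbit space is disconnected too.
\<close>

section \<open>Disconnected spaces are not rationally acyclic\<close>

text \<open>Given a separation into \<open>U\<close> and \<open>V\<close> with points u and v, the
  0-cycle u - v would be the boundary of some \<open>d\<close>. Count coefficients of 0-simplices
  lying in \<open>U\<close>: the cycle gives 1, but the boundary of a 1-simplex gives 0, since its
  image is connected and so both or neither of its endpoints lie in \<open>U\<close>.\<close>

lemma rationally_acyclic_imp_connected_space:
  assumes acyclic: "rationally_acyclic X"
  shows "connected_space X"
proof (rule ccontr)
  assume "\<not> connected_space X"
  then obtain U V where UV: "openin X U" "openin X V" "topspace X \<subseteq> U \<union> V" "U \<inter> V = {}"
    and "U \<noteq> {}" "V \<noteq> {}"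
    unfolding connected_space_def by blast
  then obtain u v where u: "u \<in> U" and v: "v \<in> V" by blast
  have uX: "u \<in> topspace X" and vX: "v \<in> topspace X"
    using u v UV openin_subset by blast+
  have vU: "v \<notin> U" using v UV by blast
  \<comment> \<open>\<open>e\<close> is the only point of the standard 0-simplex, so
    \<open>g e\<close> is the point that a 0-simplex \<open>g\<close> represents. The restrictions
    below make \<open>a\<close> and \<open>b\<close> extensional, as singular simplices must
    be.\<close>
  define e :: "nat \<Rightarrow> real" where "e = (\<lambda>j. if j = 0 then 1 else 0)"
  have e: "standard_simplex 0 = {e}"
    by (simp add: standard_simplex_0 e_def)
  define a where "a = restrict (\<lambda>_. u) (standard_simplex 0)"
  define b where "b = restrict (\<lambda>_. v) (standard_simplex 0)"
  have ae: "a e = u" and be: "b e = v"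
    by (simp_all add: a_def b_def e)
  have ab: "a \<noteq> b" using ae be u vU by metis
  have sa: "singular_simplex 0 X a" and sb: "singular_simplex 0 X b"
    unfolding singular_simplex_def a_def b_def using uX vX
    by (auto intro: continuous_map_eq[where f = "\<lambda>_. u"] continuous_map_eq[where f = "\<lambda>_. v"])
  define c :: "'a rat_chain" where "c = Poly_Mapping.single a 1 - Poly_Mapping.single b 1"
  have lookup_c: "Poly_Mapping.lookup c g = (if g = a then 1 else if g = b then -1 else 0)" for g
    using ab by (auto simp: c_def lookup_minus lookup_single when_def)
  have keys_c: "Poly_Mapping.keys c = {a, b}"
    by (auto simp: in_keys_iff lookup_c split: if_splits)
  have "rat_reduced_cycle 0 X c"
    using ab sa sb
    by (simp add: rat_reduced_cycle_def rat_singular_chain_def augmentation_def keys_c lookup_c)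
  then obtain d where d: "rat_singular_chain (Suc 0) X d" and dc: "rat_boundary (Suc 0) d = c"
    using acyclic unfolding rationally_acyclic_def by blast
  define K where "K = Poly_Mapping.keys d"
  \<comment> \<open>\<open>S\<close> is a finite stand-in for all 0-simplices in \<open>U\<close>:
    it collects those that occur in \<open>c\<close> or as a face of a simplex of
    \<open>d\<close>.\<close>
  define S where "S = {g \<in> {a, b} \<union> (\<lambda>(k, f). singular_face (Suc 0) k f) ` ({..Suc 0} \<times> K).
    g e \<in> U}"
  have finS: "finite S" unfolding S_def K_def by simp
  have faces: "singular_face (Suc 0) 0 f \<in> S \<longleftrightarrow> singular_face (Suc 0) (Suc 0) f \<in> S"
    if f: "f \<in> K" for f
  proof -
    let ?I = "f ` standard_simplex (Suc 0)"
    have cont: "continuous_map (subtopology (powertop_real UNIV) (standard_simplex (Suc 0))) X f"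
      using d f by (auto simp: rat_singular_chain_def K_def singular_simplex_def)
    have conn: "connectedin X ?I"
      by (rule connectedin_continuous_map_image[OF cont])
        (simp add: connectedin_subtopology connectedin_standard_simplex)
    have face: "singular_face (Suc 0) k f e \<in> ?I" if "k \<le> Suc 0" for k
      using simplical_face_in_standard_simplex[of "Suc 0" k e] that
      by (auto simp: singular_face_def e)
    have "?I \<subseteq> U \<or> ?I \<inter> U = {}"
    proof (rule ccontr)
      assume not: "\<not> ?thesis"
      have "?I \<subseteq> U \<union> V"
        using conn UV(3) connectedin_subset_topspace by blast
      with not connectedinD[OF conn UV(1,2)] UV(4) show False by blast
    qed
    then show ?thesis
      using face[of 0] face[of "Suc 0"] f unfolding S_def by auto
  qed
  have "(\<Sum>g\<in>S. Poly_Mapping.lookup c g) = (\<Sum>g\<in>S. if g = a then 1 else 0)"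
    using vU be by (intro sum.cong) (auto simp: lookup_c S_def)
  also have "\<dots> = 1"
    using finS ae u by (simp add: S_def)
  finally have one: "(\<Sum>g\<in>S. Poly_Mapping.lookup c g) = 1" .
  have "(\<Sum>g\<in>S. Poly_Mapping.lookup c g) = (\<Sum>f\<in>K. \<Sum>k\<le>Suc 0. \<Sum>g\<in>S.
      Poly_Mapping.lookup (Poly_Mapping.single (singular_face (Suc 0) k f)
        ((-1) ^ k * Poly_Mapping.lookup d f)) g)"
    unfolding dc[symmetric] rat_boundary_def K_def[symmetric]
    by (simp add: lookup_sum lookup_add sum.distrib sum.swap[of _ S])
  also have "\<dots> = (\<Sum>f\<in>K. \<Sum>k\<le>Suc 0.
      if singular_face (Suc 0) k f \<in> S then (-1) ^ k * Poly_Mapping.lookup d f else 0)"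
    using finS by (simp add: lookup_single when_def)
  also have "\<dots> = 0"
    \<comment> \<open>The two faces of a 1-simplex carry opposite signs and are either both counted
      or both left out.\<close>
    using faces by (intro sum.neutral) simp
  finally show False using one by simp
qed

section \<open>Orbit spaces and order complexes\<close>

text \<open>Invariant sets are saturated for the orbit map, so the images of \<open>W1\<close> and
  \<open>W2\<close> are again open and disjoint.\<close>

lemma not_connected_orbit_space:
  assumes refl: "\<And>x. x \<in> topspace X \<Longrightarrow> x \<in> action_orbit act G x"
    and opn: "openin X W1" "openin X W2"
    and cover: "topspace X \<subseteq> W1 \<union> W2" and disj: "W1 \<inter> W2 = {}" and ne: "W1 \<noteq> {}" "W2 \<noteq> {}"
    and inv: "\<And>g x. g \<in> G \<Longrightarrow> x \<in> W1 \<Longrightarrow> act g x \<in> topspace X \<Longrightarrow> act g x \<in> W1"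
      "\<And>g x. g \<in> G \<Longrightarrow> x \<in> W2 \<Longrightarrow> act g x \<in> topspace X \<Longrightarrow> act g x \<in> W2"
  shows "\<not> connected_space (orbit_space act G X)"
proof -
  let ?o = "action_orbit act G"
  have W: "W1 \<subseteq> topspace X" "W2 \<subseteq> topspace X"
    using opn openin_subset by auto
  \<comment> \<open>If x and y have the same orbit, then y, lying in its own orbit, equals
    \<open>act g x\<close> for some g; invariance of \<open>W\<close> does the rest.\<close>
  have sat: "y \<in> W"
    if "W \<subseteq> topspace X" "\<And>g x. g \<in> G \<Longrightarrow> x \<in> W \<Longrightarrow> act g x \<in> topspace X \<Longrightarrow> act g x \<in> W"
      "x \<in> W" "y \<in> topspace X" "?o y = ?o x" for W x y
    using that refl[of y] unfolding action_orbit_def by auto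
  have pre: "{x \<in> topspace X. ?o x \<in> ?o ` W1} = W1" "{x \<in> topspace X. ?o x \<in> ?o ` W2} = W2"
    using sat[OF W(1) inv(1)] sat[OF W(2) inv(2)] W by blast+
  have "openin (orbit_space act G X) (?o ` W1)" "openin (orbit_space act G X) (?o ` W2)"
    using pre opn W by (simp_all add: openin_orbit_space image_mono)
  moreover have "topspace (orbit_space act G X) \<subseteq> ?o ` W1 \<union> ?o ` W2"
    using cover by (auto simp: topspace_orbit_space)
  moreover have "?o ` W1 \<inter> ?o ` W2 = {}"
    using pre W disj by blast
  ultimately show ?thesis
    using ne unfolding connected_space_def by blast
qed

lemma permute_partition_inv:
  assumes "bij s"
  shows "permute_partition (inv_into UNIV s) (permute_partition s Q) = Q"
  using assms by (simp add: permute_partition_def image_comp bij_is_inj)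

text \<open>The set is a union of preimages of the open set \<open>- {0}\<close> under coordinate
  functions, which are continuous for pointwise convergence.\<close>

lemma openin_geometric_realization_support:
  "openin (geometric_realization K) {x \<in> topspace (geometric_realization K). \<exists>Q\<in>V. x Q \<noteq> 0}"
proof -
  have cont: "continuous_map (geometric_realization K) euclidean (\<lambda>x. x Q)" for Q
    unfolding geometric_realization_def
    by (intro continuous_map_from_subtopology continuous_map_product_projection) simp
  have "openin (geometric_realization K) {x \<in> topspace (geometric_realization K). x Q \<in> - {0}}" for Q
    by (rule openin_continuous_map_preimage[OF cont]) auto
  then have "openin (geometric_realization K)
      (\<Union>Q\<in>V. {x \<in> topspace (geometric_realization K). x Q \<in> - {0}})"
    by blast
  moreover have "(\<Union>Q\<in>V. {x \<in> topspace (geometric_realization K). x Q \<in> - {0}})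
      = {x \<in> topspace (geometric_realization K). \<exists>Q\<in>V. x Q \<noteq> 0}"
    by auto
  ultimately show ?thesis by simp
qed

lemma vertex_in_geometric_realization:
  assumes "{Q} \<in> K"
  shows "(\<lambda>R. if R = Q then 1 else 0) \<in> topspace (geometric_realization K)"
proof -
  have *: "{R. (if R = Q then 1 else 0 :: real) \<noteq> 0} = {Q}" by auto
  show ?thesis
    unfolding geometric_realization_def topspace_subtopology
    using assms by (simp add: * flip: fun_eq_iff)
qed

text \<open>The support of a point is a nonempty chain, so by incomparability it lies entirely in
  \<open>V1\<close> or entirely in \<open>V2\<close>. This separates the realization, and stabilizer
  invariance carries the separation over to the orbit space.\<close>

lemma not_connected_X_space:
  assumes V: "Pi_interval n l P = V1 \<union> V2" and ne: "V1 \<noteq> {}" "V2 \<noteq> {}"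
    and incomp: "\<And>Q R. Q \<in> V1 \<Longrightarrow> R \<in> V2 \<Longrightarrow> \<not> refines {1..n} Q R \<and> \<not> refines {1..n} R Q"
    and inv: "\<And>s Q. s \<in> partition_stabilizer n P \<Longrightarrow> Q \<in> V1 \<Longrightarrow>
        permute_partition s Q \<in> Pi_interval n l P \<Longrightarrow> permute_partition s Q \<in> V1"
      "\<And>s Q. s \<in> partition_stabilizer n P \<Longrightarrow> Q \<in> V2 \<Longrightarrow>
        permute_partition s Q \<in> Pi_interval n l P \<Longrightarrow> permute_partition s Q \<in> V2"
    and P: "set_partition n P"
  shows "\<not> connected_space (X_space n l P)"
proof -
  define K where "K = order_complex (refines {1..n}) (Pi_interval n l P)"
  let ?X = "geometric_realization K"
  \<comment> \<open>Asking for one nonzero coordinate in \<open>V\<close> makes openness immediate;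
    for \<open>V1\<close> and \<open>V2\<close> it amounts to the whole support lying there.\<close>
  define W where "W V = {x \<in> topspace ?X. \<exists>Q\<in>V. x Q \<noteq> 0}" for V
  have supp: "{Q. x Q \<noteq> 0} \<in> K" if "x \<in> topspace ?X" for x
    using that by (auto simp: geometric_realization_def)
  have suppV: "{Q. x Q \<noteq> 0} \<subseteq> V1 \<union> V2" "{Q. x Q \<noteq> 0} \<noteq> {}"
    "\<And>Q R. x Q \<noteq> 0 \<Longrightarrow> x R \<noteq> 0 \<Longrightarrow> refines {1..n} Q R \<or> refines {1..n} R Q"
    if "x \<in> topspace ?X" for x
    using supp[OF that] unfolding K_def order_complex_def V Complete_Partial_Order.chain_def by auto
  have vertex: "{Q} \<in> K" if "Q \<in> Pi_interval n l P" for Q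
    using that
    by (auto simp: K_def order_complex_def Complete_Partial_Order.chain_def Pi_interval_def
        refines_def)
  have W_ne: "W V' \<noteq> {}" if "V' \<noteq> {}" "V' \<subseteq> V1 \<union> V2" for V'
  proof -
    obtain Q where "Q \<in> V'" using \<open>V' \<noteq> {}\<close> by blast
    then have "(\<lambda>R. if R = Q then 1 else 0) \<in> W V'"
      using vertex_in_geometric_realization[OF vertex] that V by (fastforce simp: W_def)
    then show ?thesis by blast
  qed
  have W_inv: "permute_point s x \<in> W V"
    if s: "s \<in> partition_stabilizer n P" and x: "x \<in> W V"
      and px: "permute_point s x \<in> topspace ?X"
      and Vinv: "\<And>Q. Q \<in> V \<Longrightarrow> permute_partition s Q \<in> Pi_interval n l P \<Longrightarrow> permute_partition s Q \<in> V"
    for V s x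
  proof -
    obtain Q where Q: "Q \<in> V" "x Q \<noteq> 0" using x by (auto simp: W_def)
    have "bij s"
      using s by (auto simp: partition_stabilizer_def intro: permutes_bij)
    then have "permute_point s x (permute_partition s Q) \<noteq> 0"
      using Q by (simp add: permute_point_def permute_partition_inv)
    \<comment> \<open>The moved vertex is in the support of a point of the realization, hence in the
      interval, as the invariance hypothesis demands.\<close>
    moreover from this have "permute_partition s Q \<in> Pi_interval n l P"
      using suppV(1)[OF px] V by blast
    ultimately show ?thesis
      using Q px Vinv by (auto simp: W_def)
  qed
  show ?thesis
    unfolding X_space_def K_def[symmetric]
  proof (rule not_connected_orbit_space[where ?W1.0 = "W V1" and ?W2.0 = "W V2"])
    fix x assume "x \<in> topspace ?X"
    have "id \<in> partition_stabilizer n P"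
      by (simp add: partition_stabilizer_def permutes_id permute_partition_def)
    moreover have "permute_point id x = x"
      by (simp add: permute_point_def permute_partition_def)
    ultimately show "x \<in> action_orbit permute_point (partition_stabilizer n P) x"
      unfolding action_orbit_def by (metis imageI)
  next
    show "openin ?X (W V1)" "openin ?X (W V2)"
      unfolding W_def by (rule openin_geometric_realization_support)+
    show "topspace ?X \<subseteq> W V1 \<union> W V2"
      using suppV(1,2) unfolding W_def by blast
    show "W V1 \<inter> W V2 = {}"
      using suppV(3) incomp unfolding W_def by blast
    show "W V1 \<noteq> {}" "W V2 \<noteq> {}"
      using W_ne ne by auto
  qed (use W_inv inv in blast)+
qed

section \<open>Splittings of blocks\<close>

text \<open>A set of sizes loses nothing for partitions of type \<lambda>, whose blocks have
  pairwise distinct sizes.\<close>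

definition block_sizes :: "nat set set \<Rightarrow> nat set \<Rightarrow> nat set"
  where "block_sizes Q C = card ` {B \<in> Q. B \<subseteq> C}"

definition splits_by :: "(nat \<Rightarrow> nat) \<Rightarrow> nat set set \<Rightarrow> nat set set \<Rightarrow> bool"
  where "splits_by h Q P \<longleftrightarrow> (\<forall>C\<in>P. block_sizes Q C = {h (card C), card C - h (card C)})"

text \<open>The blocks of \<open>Q\<close> inside \<open>C\<close> partition \<open>C\<close>, and
  injectivity of \<open>card\<close> turns the sum over blocks into a sum over sizes.\<close>

lemma sum_block_sizes:
  assumes "refines A Q P" "finite A" "inj_on card Q" "C \<in> P"
  shows "\<Sum>(block_sizes Q C) = card C"
proof -
  have part: "partition_on C {B \<in> Q. B \<subseteq> C}"
    using refines_obtains_subset assms by blast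
  have "finite C"
    using assms by (auto simp: refines_def partition_on_def intro: finite_subset)
  then have "card C = (\<Sum>B\<in>{B \<in> Q. B \<subseteq> C}. card B)"
    using part card_Union_disjoint[of "{B \<in> Q. B \<subseteq> C}"]
    by (auto simp: partition_on_def disjoint_def intro: finite_subset)
  also have "\<dots> = \<Sum>(block_sizes Q C)"
    unfolding block_sizes_def
    by (subst sum.reindex) (use assms(3) in \<open>auto intro: inj_on_subset\<close>)
  finally show ?thesis by simp
qed

text \<open>A common size would belong to a single block, nonempty and contained in the two disjoint
  sets \<open>C\<close> and \<open>D\<close>.\<close>

lemma block_sizes_disjoint:
  assumes "refines A Q P" "inj_on card Q" "C \<in> P" "D \<in> P" "C \<noteq> D"
  shows "block_sizes Q C \<inter> block_sizes Q D = {}"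
proof -
  have "C \<inter> D = {}"
    using assms(1,3-5) by (auto simp: refines_def partition_on_def disjoint_def)
  moreover have "{} \<notin> Q"
    using assms(1) by (simp add: refines_def partition_on_def)
  moreover have "B = B'" if "card B = card B'" "B \<in> Q" "B' \<in> Q" for B B'
    using inj_onD[OF assms(2)] that by blast
  ultimately have "card B \<noteq> card B'" if "B \<in> Q" "B \<subseteq> C" "B' \<in> Q" "B' \<subseteq> D" for B B'
    using that by (metis Int_greatest subset_empty)
  then show ?thesis by (auto simp: block_sizes_def)
qed

lemma block_sizes_mono: "D \<subseteq> C \<Longrightarrow> block_sizes Q D \<subseteq> block_sizes Q C"
  unfolding block_sizes_def by blast

lemma partition_type_set:
  assumes "distinct (map card Bs)"
  shows "partition_type (set Bs) = mset (map card Bs)"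
  using assms by (simp add: partition_type_def mset_set_set distinct_map)

text \<open>With distinct parts there are as many sizes as blocks, which forces \<open>card\<close>
  to be injective.\<close>

lemma partition_type_distinct:
  assumes "partition_type Q = mset xs" "distinct xs" "finite Q"
  shows "inj_on card Q" "card ` Q = set xs"
proof -
  show im: "card ` Q = set xs"
    using arg_cong[OF assms(1), of set_mset] assms(3) by (simp add: partition_type_def)
  have "card Q = length xs"
    using arg_cong[OF assms(1), of size] by (simp add: partition_type_def)
  then show "inj_on card Q"
    using im assms(2,3) by (simp add: eq_card_imp_inj_on distinct_card)
qed

text \<open>This allows a partition below \<open>P\<close> to be prescribed block by block and
  recovered from its restriction to each block.\<close>

lemma partition_on_UN_partitions:
  assumes P: "partition_on A P" and F: "\<And>C. C \<in> P \<Longrightarrow> partition_on C (F C)"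
  shows "refines A (\<Union>C\<in>P. F C) P" "\<And>C. C \<in> P \<Longrightarrow> {B \<in> (\<Union>C\<in>P. F C). B \<subseteq> C} = F C"
proof -
  have sub: "B \<subseteq> C" "B \<noteq> {}" if "B \<in> F C" "C \<in> P" for B C
    using F[OF that(2)] that by (auto simp: partition_on_def)
  have eq: "C = D" if "B \<subseteq> C" "B \<subseteq> D" "B \<noteq> {}" "C \<in> P" "D \<in> P" for B C D
  proof -
    have "C \<inter> D \<noteq> {}" using that(1-3) by blast
    then show ?thesis
      using P that(4,5) by (auto simp: partition_on_def disjoint_def)
  qed
  show "{B \<in> (\<Union>C\<in>P. F C). B \<subseteq> C} = F C" if "C \<in> P" for C
  proof -
    have "B \<in> F C" if "B \<in> F D" "D \<in> P" "B \<subseteq> C" for B D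
      using sub[OF that(1,2)] eq[of B C D] that \<open>C \<in> P\<close> by simp
    then show ?thesis using sub(1)[OF _ that] that by auto
  qed
  have "partition_on A (\<Union>C\<in>P. F C)"
  proof (rule partition_onI)
    show "\<Union>(\<Union>C\<in>P. F C) = A"
    proof -
      have "\<Union>(\<Union>C\<in>P. F C) = (\<Union>C\<in>P. \<Union>(F C))" by blast
      also have "\<dots> = (\<Union>C\<in>P. C)"
        using F by (auto simp: partition_on_def)
      finally show ?thesis using P by (simp add: partition_on_def)
    qed
    show "{} \<notin> (\<Union>C\<in>P. F C)"
      using sub(2) by blast
    show "disjnt B B'" if BB: "B \<in> (\<Union>C\<in>P. F C)" "B' \<in> (\<Union>C\<in>P. F C)" "B \<noteq> B'" for B B'
    proof -
      obtain C C' where C: "C \<in> P" "B \<in> F C" "C' \<in> P" "B' \<in> F C'" using BB by blast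
      show ?thesis
      proof (cases "C = C'")
        case True
        then show ?thesis
          using F[OF C(1)] C BB(3) by (auto simp: partition_on_def disjoint_def disjnt_def)
      next
        case False
        then have "C \<inter> C' = {}" using P C(1,3) by (auto simp: partition_on_def disjoint_def)
        then show ?thesis using sub(1)[OF C(2,1)] sub(1)[OF C(4,3)] by (auto simp: disjnt_def)
      qed
    qed
  qed
  then show "refines A (\<Union>C\<in>P. F C) P"
    using P sub unfolding refines_def by blast
qed

text \<open>Each block \<open>C\<close> is cut into a subset \<open>g C\<close> of the prescribed
  size and its complement. The function \<open>g\<close> is handed out so that the type of the
  result can be computed.\<close>

lemma splits_by_exists:
  assumes P: "partition_on A P" and h: "\<And>C. C \<in> P \<Longrightarrow> 0 < h (card C) \<and> h (card C) < card C"
  obtains g where "\<And>C. C \<in> P \<Longrightarrow> card (g C) = h (card C) \<and> card (C - g C) = card C - h (card C)"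
    "refines A (\<Union>C\<in>P. {g C, C - g C}) P" "splits_by h (\<Union>C\<in>P. {g C, C - g C}) P"
proof -
  have "\<forall>C\<in>P. \<exists>X\<subseteq>C. card X = h (card C)"
    using h by (meson less_imp_le_nat obtain_subset_with_card_n)
  then obtain g where g: "\<And>C. C \<in> P \<Longrightarrow> g C \<subseteq> C \<and> card (g C) = h (card C)"
    by metis
  \<comment> \<open>Infinite sets have cardinality 0, so a positive cardinality yields
    finiteness.\<close>
  have fin: "finite C" if "C \<in> P" for C
    using h[OF that] by (intro card_ge_0_finite) auto
  have cards: "card (g C) = h (card C)" "card (C - g C) = card C - h (card C)" if "C \<in> P" for C
    using g[OF that] fin[OF that] by (auto simp: card_Diff_subset finite_subset)
  have "partition_on C {g C, C - g C}" if "C \<in> P" for C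
  proof -
    have "g C \<noteq> {}" "C - g C \<noteq> {}"
      using cards[OF that] h[OF that] by (metis card.empty less_irrefl, metis card.empty less_irrefl zero_less_diff)
    then show ?thesis
      using g[OF that] by (auto simp: partition_on_def disjoint_def)
  qed
  note U = partition_on_UN_partitions[OF P this]
  have "splits_by h (\<Union>C\<in>P. {g C, C - g C}) P"
    using U(2) cards by (simp add: splits_by_def block_sizes_def)
  with cards U(1) show thesis
    by (intro that) auto
qed

section \<open>Invariance of splittings, types and refinement under permutations\<close>

lemma block_sizes_permute:
  assumes "inj s"
  shows "block_sizes (permute_partition s Q) (s ` C) = block_sizes Q C"
proof -
  have "{B \<in> permute_partition s Q. B \<subseteq> s ` C} = (`) s ` {B \<in> Q. B \<subseteq> C}"
    using assms by (auto simp: permute_partition_def inj_image_subset_iff)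
  then show ?thesis
    using assms by (simp add: block_sizes_def image_comp card_image inj_on_subset[OF assms])
qed

text \<open>A stabilizing permutation may exchange blocks of \<open>P\<close>, but only blocks of
  equal size, and \<open>h\<close> depends on nothing but the size.\<close>

lemma splits_by_permute:
  assumes "inj s" "permute_partition s P = P" "splits_by h Q P"
  shows "splits_by h (permute_partition s Q) P"
  unfolding splits_by_def
proof
  fix C assume "C \<in> P"
  then have "C \<in> (`) s ` P"
    using assms(2) by (simp add: permute_partition_def)
  then obtain C' where "C' \<in> P" "C = s ` C'" by blast
  then show "block_sizes (permute_partition s Q) C = {h (card C), card C - h (card C)}"
    using assms by (simp add: block_sizes_permute splits_by_def card_image inj_on_subset[OF assms(1)])
qed

lemma partition_type_permute:
  assumes "inj s"
  shows "partition_type (permute_partition s Q) = partition_type Q"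
proof -
  have "inj_on ((`) s) Q"
    using assms by (meson inj_image_eq_iff inj_onI)
  then have "mset_set (permute_partition s Q) = image_mset ((`) s) (mset_set Q)"
    by (simp add: permute_partition_def image_mset_mset_set)
  then show ?thesis
    using assms by (simp add: partition_type_def image_mset.compositionality comp_def card_image
        inj_on_subset[OF assms])
qed

lemma refines_permute:
  assumes "s permutes A" "refines A Q R"
  shows "refines A (permute_partition s Q) (permute_partition s R)"
proof -
  have part: "partition_on A (permute_partition s S)" if "partition_on A S" for S
  proof -
    have "inj_on s A" "s ` A = A"
      using permutes_inj_on[OF assms(1)] permutes_image[OF assms(1)] by auto
    then have "partition_on A ((`) s ` S - {{}})"
      using partition_on_inj_image[OF that] by metis
    \<comment> \<open>Removing the empty set from the image changes nothing, as images of nonempty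
      blocks are nonempty.\<close>
    moreover have "{} \<notin> (`) s ` S"
      using that by (auto simp: partition_on_def)
    ultimately show ?thesis
      by (simp add: permute_partition_def)
  qed
  then show ?thesis
    using assms(2) image_mono[of _ _ s] unfolding refines_def permute_partition_def
    by (simp add: ball_simps bex_simps) metis
qed

section \<open>The two kinds of partitions of type \<open>(7,6,4,3,2,1)\<close> below \<open>(10,8,5)\<close>\<close>

text \<open>The larger part of the block size \<open>c\<close> in either grouping; only \<open>c \<in> {10, 8, 5}\<close> matters.\<close>

definition h1 :: "nat \<Rightarrow> nat"
  where "h1 c = (if c = 10 then 7 else if c = 8 then 6 else 4)"

definition h2 :: "nat \<Rightarrow> nat"
  where "h2 c = (if c = 10 then 6 else if c = 8 then 7 else 3)"

lemma lambda_subset_sums: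
  fixes S :: "nat set"
  assumes "S \<subseteq> {7, 6, 4, 3, 2, 1}"
  shows "\<Sum>S = 10 \<Longrightarrow> S \<in> {{7, 3}, {6, 4}, {7, 2, 1}, {6, 3, 1}, {4, 3, 2, 1}}"
    and "\<Sum>S = 8 \<Longrightarrow> S \<in> {{7, 1}, {6, 2}, {4, 3, 1}}"
    and "\<Sum>S = 5 \<Longrightarrow> S \<in> {{4, 1}, {3, 2}}"
proof -
  have S: "S \<in> Pow {7, 6, 4, 3, 2, 1}" using assms by blast
  show "\<Sum>S = 10 \<Longrightarrow> S \<in> {{7, 3}, {6, 4}, {7, 2, 1}, {6, 3, 1}, {4, 3, 2, 1}}"
    "\<Sum>S = 8 \<Longrightarrow> S \<in> {{7, 1}, {6, 2}, {4, 3, 1}}" "\<Sum>S = 5 \<Longrightarrow> S \<in> {{4, 1}, {3, 2}}"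
    \<comment> \<open>The power set is expanded into its 64 members, and each is checked by
      computing its sum.\<close>
    using S unfolding Pow_insert Pow_empty image_insert image_empty Un_insert_left Un_empty_left
    by (elim insertE emptyE; simp)+
qed

lemma mu_blocks:
  assumes "set_partition n P" "partition_type P = {#10, 8, 5#}"
  obtains C10 C8 C5 where "P = {C10, C8, C5}" "card C10 = 10" "card C8 = 8" "card C5 = 5"
proof -
  have fin: "finite P" using assms(1) by (intro finite_elements) auto
  have "partition_type P = mset [10, 8, 5]" using assms(2) by simp
  note d = partition_type_distinct[OF this _ fin, simplified]
  from d(2) obtain C10 C8 C5
    where C: "C10 \<in> P" "card C10 = 10" "C8 \<in> P" "card C8 = 8" "C5 \<in> P" "card C5 = 5"
    by (smt (verit) imageE insertCI)
  have "C \<in> {C10, C8, C5}" if "C \<in> P" for C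
  proof -
    have "card C \<in> {10, 8, 5}" using d(2) that by blast
    then show ?thesis using C inj_onD[OF d(1) _ that] by auto
  qed
  then have "P = {C10, C8, C5}" using C by blast
  with C that show thesis by blast
qed

lemma lambda_sizes:
  assumes "set_partition n Q" "partition_type Q = {#7, 6, 4, 3, 2, 1#}"
  shows "inj_on card Q" "card ` Q = {7, 6, 4, 3, 2, 1}"
proof -
  have fin: "finite Q" using assms(1) by (intro finite_elements) auto
  have "partition_type Q = mset [7, 6, 4, 3, 2, 1]" using assms(2) by simp
  note d = partition_type_distinct[OF this _ fin]
  show "inj_on card Q" "card ` Q = {7, 6, 4, 3, 2, 1}"
    using d by simp_all
qed

text \<open>The sizes inside the three blocks of \<open>P\<close> are pairwise disjoint sets of
  parts with sums 10, 8 and 5. Of the 5 * 3 * 2 triples of candidates from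
  \<open>lambda_subset_sums\<close>, only two are pairwise disjoint.\<close>

lemma lambda_below_mu_cases:
  assumes ref: "refines {1..n} Q P" and Q: "partition_type Q = {#7, 6, 4, 3, 2, 1#}"
    and P: "partition_type P = {#10, 8, 5#}"
  shows "splits_by h1 Q P \<or> splits_by h2 Q P"
proof -
  have part: "set_partition n Q" "set_partition n P" using ref by (auto simp: refines_def)
  note l = lambda_sizes[OF part(1) Q]
  obtain C10 C8 C5 where C: "P = {C10, C8, C5}" "card C10 = 10" "card C8 = 8" "card C5 = 5"
    using mu_blocks[OF part(2) P] .
  have sub: "block_sizes Q C \<subseteq> {7, 6, 4, 3, 2, 1}" for C
    using l(2) by (auto simp: block_sizes_def)
  have memP: "C10 \<in> P" "C8 \<in> P" "C5 \<in> P" using C(1) by simp_all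
  have sums: "\<Sum>(block_sizes Q C10) = 10" "\<Sum>(block_sizes Q C8) = 8" "\<Sum>(block_sizes Q C5) = 5"
    using sum_block_sizes[OF ref finite_atLeastAtMost l(1) memP(1)]
      sum_block_sizes[OF ref finite_atLeastAtMost l(1) memP(2)]
      sum_block_sizes[OF ref finite_atLeastAtMost l(1) memP(3)] C(2-4) by linarith+
  have "card C10 \<noteq> card C8" "card C10 \<noteq> card C5" "card C8 \<noteq> card C5"
    unfolding C(2-4) by simp_all
  then have "C10 \<noteq> C8" "C10 \<noteq> C5" "C8 \<noteq> C5" by metis+
  then have disj: "block_sizes Q C10 \<inter> block_sizes Q C8 = {}"
    "block_sizes Q C10 \<inter> block_sizes Q C5 = {}" "block_sizes Q C8 \<inter> block_sizes Q C5 = {}"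
    using block_sizes_disjoint[OF ref l(1)] memP by simp_all
  have cases: "S = {7, 3} \<and> T = {6, 2} \<and> U = {4, 1} \<or> S = {6, 4} \<and> T = {7, 1} \<and> U = {3, 2}"
    if "S \<in> {{7, 3}, {6, 4}, {7, 2, 1}, {6, 3, 1}, {4, 3, 2, 1}}"
      "T \<in> {{7, 1}, {6, 2}, {4, 3, 1}}" "U \<in> {{4, 1}, {3, 2}}"
      "S \<inter> T = {}" "S \<inter> U = {}" "T \<inter> U = {}" for S T U :: "nat set"
    using that by (elim insertE emptyE; simp only:; simp)
  have "block_sizes Q C10 = {7, 3} \<and> block_sizes Q C8 = {6, 2} \<and> block_sizes Q C5 = {4, 1}
    \<or> block_sizes Q C10 = {6, 4} \<and> block_sizes Q C8 = {7, 1} \<and> block_sizes Q C5 = {3, 2}"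
    by (rule cases[OF lambda_subset_sums(1)[OF sub sums(1)] lambda_subset_sums(2)[OF sub sums(2)]
          lambda_subset_sums(3)[OF sub sums(3)] disj])
  then show ?thesis
    unfolding splits_by_def C(1) ball_simps h1_def h2_def C(2-4) by (elim disjE) simp_all
qed

text \<open>A block of \<open>R\<close> inside a block of \<open>P\<close> of size c is a union of
  blocks of \<open>Q1\<close> and also of \<open>Q2\<close>. Its size is thus a subset sum of both
  {7,3} and {6,4}, of both {6,2} and {7,1}, or of both {4,1} and {3,2}; the only common subset sums
  are 0 and c. So it is the whole block of \<open>P\<close>.\<close>

lemma mixed_upper_bound_eq:
  assumes R: "refines {1..n} R P" and P: "partition_type P = {#10, 8, 5#}"
    and Q1: "refines {1..n} Q1 R" "partition_type Q1 = {#7, 6, 4, 3, 2, 1#}" "splits_by h1 Q1 P"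
    and Q2: "refines {1..n} Q2 R" "partition_type Q2 = {#7, 6, 4, 3, 2, 1#}" "splits_by h2 Q2 P"
  shows "R = P"
proof -
  have part: "set_partition n Q1" "set_partition n Q2" "set_partition n P" "set_partition n R"
    using Q1 Q2 R by (auto simp: refines_def)
  obtain C10 C8 C5 where C: "P = {C10, C8, C5}" "card C10 = 10" "card C8 = 8" "card C5 = 5"
    using mu_blocks[OF part(3) P] .
  have "\<forall>D\<in>R. \<exists>C\<in>P. D = C"
  proof
    fix D assume D: "D \<in> R"
    obtain C' where C': "C' \<in> P" "D \<subseteq> C'" using R D by (auto simp: refines_def)
    have finC': "finite C'" using C C'(1) by (auto intro: card_ge_0_finite)
    have "D \<noteq> {}" using D part(4) by (auto simp: partition_on_def)
    then have D0: "card D \<noteq> 0" using finC' C'(2) by (auto dest: finite_subset)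
    have sums: "\<Sum>(block_sizes Q1 D) = card D" "\<Sum>(block_sizes Q2 D) = card D"
      using sum_block_sizes[OF Q1(1)] sum_block_sizes[OF Q2(1)] D
        lambda_sizes(1)[OF part(1) Q1(2)] lambda_sizes(1)[OF part(2) Q2(2)] by auto
    have subs: "block_sizes Q1 D \<in> Pow {h1 (card C'), card C' - h1 (card C')}"
      "block_sizes Q2 D \<in> Pow {h2 (card C'), card C' - h2 (card C')}"
      using Q1(3) Q2(3) C'(1) block_sizes_mono[OF C'(2), of Q1] block_sizes_mono[OF C'(2), of Q2]
      by (simp_all add: splits_by_def)
    have "card C' = 10 \<or> card C' = 8 \<or> card C' = 5"
      using C C'(1) by auto
    then have "card D = card C'"
      using subs sums D0
      by (elim disjE) (auto simp: h1_def h2_def Pow_insert)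
    then have "D = C'" using C'(2) finC' by (simp add: card_subset_eq)
    then show "\<exists>C\<in>P. D = C" using C'(1) by blast
  qed
  then have RP: "D \<in> P" if "D \<in> R" for D using that by blast
  \<comment> \<open>Since \<open>R\<close> covers the ground set, a point of \<open>C\<close> lies
    in some block of \<open>R\<close>; that block is a block of \<open>P\<close> and meets
    \<open>C\<close>, hence equals it.\<close>
  have "C \<in> R" if "C \<in> P" for C
  proof -
    have "C \<noteq> {}" using \<open>C \<in> P\<close> part(3) by (auto simp: partition_on_def)
    then obtain x where x: "x \<in> C" by blast
    then have "x \<in> {1..n}" using \<open>C \<in> P\<close> part(3) by (auto simp: partition_on_def)
    then have "x \<in> \<Union>R" using part(4) by (simp add: partition_on_def)
    then obtain D where D: "D \<in> R" "x \<in> D" by blast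
    have "C \<inter> D \<noteq> {}" using x D(2) by blast
    moreover have "\<forall>X\<in>P. \<forall>Y\<in>P. X \<noteq> Y \<longrightarrow> X \<inter> Y = {}"
      using part(3) by (simp add: partition_on_def disjoint_def)
    ultimately have "C = D"
      using RP[OF D(1)] \<open>C \<in> P\<close> by blast
    then show "C \<in> R" using D(1) by simp
  qed
  then have "refines {1..n} P R"
    using part(3,4) by (auto simp: refines_def)
  then show ?thesis using R refines_asym by blast
qed

section \<open>Existence of both kinds and their place in the interval\<close>

lemma lambda_split_exists:
  assumes part: "set_partition n P" and P: "partition_type P = {#10, 8, 5#}"
    and h: "h = h1 \<or> h = h2"
  obtains Q where "refines {1..n} Q P" "partition_type Q = {#7, 6, 4, 3, 2, 1#}" "splits_by h Q P"
proof -
  obtain C10 C8 C5 where C: "P = {C10, C8, C5}" "card C10 = 10" "card C8 = 8" "card C5 = 5"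
    using mu_blocks[OF part P] .
  have "0 < h (card C) \<and> h (card C) < card C" if "C \<in> P" for C
    using that C h by (auto simp: h1_def h2_def)
  from splits_by_exists[OF part this] obtain g where
    g: "\<And>C. C \<in> P \<Longrightarrow> card (g C) = h (card C) \<and> card (C - g C) = card C - h (card C)"
    and Q: "refines {1..n} (\<Union>C\<in>P. {g C, C - g C}) P" "splits_by h (\<Union>C\<in>P. {g C, C - g C}) P"
    by blast
  let ?Bs = "[g C10, C10 - g C10, g C8, C8 - g C8, g C5, C5 - g C5]"
  have eq: "(\<Union>C\<in>P. {g C, C - g C}) = set ?Bs" using C(1) by auto
  have cards: "map card ?Bs = [h 10, 10 - h 10, h 8, 8 - h 8, h 5, 5 - h 5]"
    using g[of C10] g[of C8] g[of C5] C by simp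
  \<comment> \<open>For either choice of \<open>h\<close> the six sizes are distinct and are exactly
    the parts of \<lambda>.\<close>
  have "partition_type (set ?Bs) = mset [h 10, 10 - h 10, h 8, 8 - h 8, h 5, 5 - h 5]"
    using h by (subst partition_type_set) (auto simp only: cards, auto simp: h1_def h2_def)
  also have "\<dots> = {#7, 6, 4, 3, 2, 1#}"
    using h by (auto simp: h1_def h2_def add_mset_commute)
  finally show thesis using that Q unfolding eq by blast
qed

lemma lambda_mem_interval:
  assumes ref: "refines {1..n} Q P" and Q: "partition_type Q = {#7, 6, 4, 3, 2, 1#}"
    and P: "partition_type P = {#10, 8, 5#}"
  shows "Q \<in> Pi_interval n {#7, 6, 4, 3, 2, 1#} P"
proof -
  have part: "set_partition n Q" using ref by (auto simp: refines_def)
  \<comment> \<open>An element of type \<lambda> is the join of itself alone; its sizes tell it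
    apart from the singletons, and its number of blocks from \<open>P\<close>.\<close>
  have "is_join n {Q} Q"
    using part by (auto simp: is_join_def refines_refl)
  then have "Q \<in> Pi_sub n {#7, 6, 4, 3, 2, 1#}"
    using part Q unfolding Pi_sub_def by blast
  moreover have "set_partition n (singletons n)"
    unfolding singletons_def by (rule partition_on_singletons)
  then have "refines {1..n} (singletons n) Q"
    using part unfolding refines_def singletons_def partition_on_def by auto
  moreover have "Q \<noteq> singletons n"
  proof
    assume "Q = singletons n"
    then have "card ` Q \<subseteq> {1}" by (auto simp: singletons_def)
    then show False using lambda_sizes(2)[OF part Q] by simp
  qed
  moreover have "Q \<noteq> P"
  proof
    assume "Q = P"
    then have "size {#7, 6, 4, 3, 2, 1 :: nat#} = size {#10, 8, 5 :: nat#}" using P Q by simp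
    then show False by simp
  qed
  ultimately show ?thesis using ref by (simp add: Pi_interval_def)
qed

lemma not_connected_X_space_lambda_mu:
  assumes part: "set_partition n P" and P: "partition_type P = {#10, 8, 5#}"
  shows "\<not> connected_space (X_space n {#7, 6, 4, 3, 2, 1#} P)"
proof -
  let ?l = "{#7, 6, 4, 3, 2, 1#} :: nat multiset"
  let ?I = "Pi_interval n ?l P"
  \<comment> \<open>The kind of an interval element is read off from an element of type \<lambda>
    below it.\<close>
  define V where "V h = {R \<in> ?I. \<exists>Q. refines {1..n} Q R \<and> partition_type Q = ?l \<and> splits_by h Q P}"
    for h
  have I: "refines {1..n} R P" "R \<noteq> P" if "R \<in> ?I" for R
    using that by (auto simp: Pi_interval_def)
  have cover: "?I = V h1 \<union> V h2"
  proof -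
    have "R \<in> V h1 \<union> V h2" if R: "R \<in> ?I" for R
    proof -
      \<comment> \<open>The bottom element is excluded from the interval, so \<open>R\<close> is a
        join of a nonempty set and has an element of type \<lambda> below it.\<close>
      obtain S where "S \<noteq> {}" "S \<subseteq> {Q. set_partition n Q \<and> partition_type Q = ?l}" "is_join n S R"
        using R by (auto simp: Pi_interval_def Pi_sub_def)
      then obtain Q where Q: "partition_type Q = ?l" "refines {1..n} Q R"
        by (auto simp: is_join_def)
      then have "splits_by h1 Q P \<or> splits_by h2 Q P"
        using lambda_below_mu_cases[OF refines_trans[OF Q(2) I(1)[OF R]] Q(1) P] by blast
      then show ?thesis using Q R by (auto simp: V_def)
    qed
    then show ?thesis by (auto simp: V_def)
  qed
  have ne: "V h \<noteq> {}" if h: "h = h1 \<or> h = h2" for h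
  proof -
    obtain Q where Q: "refines {1..n} Q P" "partition_type Q = ?l" "splits_by h Q P"
      using lambda_split_exists[OF part P h] .
    then have "Q \<in> V h"
      using lambda_mem_interval[OF Q(1,2) P] refines_refl unfolding V_def
      by (auto simp: refines_def)
    then show ?thesis by blast
  qed
  have inv: "permute_partition s R \<in> V h"
    if s: "s \<in> partition_stabilizer n P" and R: "R \<in> V h" and I: "permute_partition s R \<in> ?I" for h s R
  proof -
    obtain Q where Q: "refines {1..n} Q R" "partition_type Q = ?l" "splits_by h Q P"
      using R by (auto simp: V_def)
    have perm: "s permutes {1..n}" "permute_partition s P = P"
      using s by (auto simp: partition_stabilizer_def)
    show ?thesis
      using I refines_permute[OF perm(1) Q(1)] splits_by_permute[OF permutes_inj[OF perm(1)] perm(2) Q(3)]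
        partition_type_permute[OF permutes_inj[OF perm(1)]] Q(2) by (auto simp: V_def)
  qed
  have incomp: "\<not> refines {1..n} Q R \<and> \<not> refines {1..n} R Q" if QR: "Q \<in> V h1" "R \<in> V h2" for Q R
  proof -
    obtain Q1 Q2 where Q: "refines {1..n} Q1 Q" "partition_type Q1 = ?l" "splits_by h1 Q1 P"
      "refines {1..n} Q2 R" "partition_type Q2 = ?l" "splits_by h2 Q2 P"
      using QR unfolding V_def by blast
    have "Q \<in> ?I" "R \<in> ?I" using QR by (auto simp: V_def)
    \<comment> \<open>An element above both kinds would equal \<open>P\<close>, which the open
      interval omits; comparability of \<open>Q\<close> and \<open>R\<close> would make the larger
      one such an element.\<close>
    then have "\<not> (refines {1..n} Q1 T \<and> refines {1..n} Q2 T)" if "T \<in> {Q, R}" for T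
      using mixed_upper_bound_eq[OF _ P _ Q(2,3) _ Q(5,6), where R = T] I[of T] that by blast
    then show ?thesis
      using refines_trans[OF Q(1), of R] refines_trans[OF Q(4), of Q] Q(1,4) by blast
  qed
  show ?thesis
    by (rule not_connected_X_space[OF cover ne ne incomp inv inv part]) auto
qed

text \<open>\<open>P\<close> is the join of any two elements of different kinds below it, by
  \<open>mixed_upper_bound_eq\<close> applied to a meet.\<close>

lemma mu_mem_Pi_sub:
  assumes part: "set_partition n P" and P: "partition_type P = {#10, 8, 5#}"
  shows "P \<in> Pi_sub n {#7, 6, 4, 3, 2, 1#}"
proof -
  obtain Q1 where Q1: "refines {1..n} Q1 P" "partition_type Q1 = {#7, 6, 4, 3, 2, 1#}"
      "splits_by h1 Q1 P"
    using lambda_split_exists[OF part P] by blast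
  obtain Q2 where Q2: "refines {1..n} Q2 P" "partition_type Q2 = {#7, 6, 4, 3, 2, 1#}"
      "splits_by h2 Q2 P"
    using lambda_split_exists[OF part P] by blast
  have "refines {1..n} P R" if R: "set_partition n R" "\<forall>Q\<in>{Q1, Q2}. refines {1..n} Q R" for R
  proof -
    \<comment> \<open>The meet of \<open>P\<close> with another upper bound \<open>R\<close> is
      still above \<open>Q1\<close> and \<open>Q2\<close> and lies below \<open>P\<close>, so it
      equals \<open>P\<close>; hence \<open>P\<close> refines \<open>R\<close>.\<close>
    let ?M = "common_refinement {P, R}"
    have "refines {1..n} ?M P" and MR: "refines {1..n} ?M R"
      using part R(1) by (auto intro!: refines_common_refinement)
    moreover have "refines {1..n} Q ?M" if "Q \<in> {Q1, Q2}" for Q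
      using that part R Q1(1) Q2(1)
      by (intro common_refinement_coarsest) (auto simp: refines_def)
    ultimately have "?M = P"
      using mixed_upper_bound_eq[OF _ P _ Q1(2,3) _ Q2(2,3)] by blast
    then show ?thesis using MR by simp
  qed
  then have "is_join n {Q1, Q2} P"
    using part Q1(1) Q2(1) by (auto simp: is_join_def)
  moreover have "set_partition n Q1" "set_partition n Q2"
    using Q1(1) Q2(1) by (auto simp: refines_def)
  ultimately have "\<exists>S. S \<noteq> {} \<and>
      S \<subseteq> {Q. set_partition n Q \<and> partition_type Q = {#7, 6, 4, 3, 2, 1#}} \<and> is_join n S P"
    using Q1(2) Q2(2) by (intro exI[of _ "{Q1, Q2}"]) simp
  then show ?thesis by (simp add: Pi_sub_def)
qed

theorem mainTheorem11:
  shows "(\<exists>P \<in> Pi_sub 23 {#7, 6, 4, 3, 2, 1#}. partition_type P = {#10, 8, 5#})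
    \<and> (\<forall>P \<in> Pi_sub 23 {#7, 6, 4, 3, 2, 1#}. partition_type P = {#10, 8, 5#} \<longrightarrow>
          \<not> connected_space (X_space 23 {#7, 6, 4, 3, 2, 1#} P))
    \<and> \<not> (\<forall>n l m. number_partition n l \<and> number_partition n m \<and> l \<noteq> m
              \<and> number_partition_refines l m \<longrightarrow>
            (\<forall>P \<in> Pi_sub n l. partition_type P = m \<longrightarrow> rationally_acyclic (X_space n l P)))"
proof (intro conjI)
  let ?l = "{#7, 6, 4, 3, 2, 1#} :: nat multiset" and ?m = "{#10, 8, 5#} :: nat multiset"
  \<comment> \<open>Consecutive intervals of lengths 10, 8 and 5 give a concrete partition of type
    \<mu>.\<close>
  let ?Bs = "[{1..10}, {11..18}, {19..23}] :: nat set list"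
  have "set_partition 23 (set ?Bs)"
    by (auto simp: partition_on_def disjoint_def)
  moreover have type: "partition_type (set ?Bs) = ?m"
    by (subst partition_type_set) simp_all
  ultimately have mem: "set ?Bs \<in> Pi_sub 23 ?l"
    by (rule mu_mem_Pi_sub)
  with type show ex: "\<exists>P \<in> Pi_sub 23 ?l. partition_type P = ?m" by blast
  have "set_partition 23 P" if "P \<in> Pi_sub 23 ?l" for P
    using that partition_on_singletons[of "{Suc 0..23}"]
    by (auto simp: Pi_sub_def is_join_def singletons_def)
  then show disc: "\<forall>P \<in> Pi_sub 23 ?l. partition_type P = ?m \<longrightarrow>
      \<not> connected_space (X_space 23 ?l P)"
    using not_connected_X_space_lambda_mu by blast
  have "number_partition 23 ?l" "number_partition 23 ?m"
    by (auto simp: number_partition_def)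
  moreover have "size ?l \<noteq> size ?m" by simp
  then have "?l \<noteq> ?m" by metis
  moreover have "number_partition_refines ?l ?m"
    unfolding number_partition_refines_def
    \<comment> \<open>The witness is the grouping that underlies \<open>h1\<close>.\<close>
    by (rule exI[of _ "{#{#7, 3#}, {#6, 2#}, {#4, 1#}#}"]) (simp add: add_mset_commute)
  \<comment> \<open>The existence of \<open>P\<close> keeps this instance of the acyclicity claim
    from being vacuous, and acyclicity would imply connectedness.\<close>
  ultimately show "\<not> (\<forall>n l m. number_partition n l \<and> number_partition n m \<and> l \<noteq> m
              \<and> number_partition_refines l m \<longrightarrow>
            (\<forall>P \<in> Pi_sub n l. partition_type P = m \<longrightarrow> rationally_acyclic (X_space n l P)))"
    using ex disc rationally_acyclic_imp_connected_space by blast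
qed

end
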